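(* Consider the problems (P), (D), (MP), (MD) and the linear map $M$ described in the context, where $s^j\in K_j$ if and only if $M^js^j\in\mathcal{K}_j$ for all $s^j\in\mathbb{R}^{q_j}$, $j\in J$, and assume that strong duality holds for (P)-(D). Assume that $M^\top\mathcal{K}^+$ is closed, that $M$ is one to one, and that for every $j\in J$ and all $s^j\in K_j$, $$M^js^j\in\partial\mathcal{K}_j\iff s^j\in\partial K_j.$$ Then the four-partitions of (P) and (MP) coincide, that is, $$B_{P}=B_{MP},\qquad N_{P}=N_{MP},\qquad R_{P}=R_{MP},\qquad T_{P}=T_{MP}.$$ In particular, the strict complementarity condition holds for (P) if and only if it holds for (MP).
   Context: Let $J=\{1,\dots,r\}$. For each $j\in J$ let $K_j\subset\mathbb{R}^{q_j}$ and $\mathcal{K}_j\subset\mathbb{R}^{r_j}$ be closed convex regular cones (regular: nonempty interior and pointed), $A^j\in\mathbb{R}^{q_j\times n}$, $b^j\in\mathbb{R}^{q_j}$, $M^j\in\mathbb{R}^{r_j\times q_j}$, and let $c\in\mathbb{R}^n$. It is assumed throughout that for all $j\in J$ and $s^j\in\mathbb{R}^{q_j}$: $s^j\in K_j$ iff $M^js^j\in\mathcal{K}_j$. Put $K=\prod_j K_j$, $\mathcal{K}=\prod_j\mathcal{K}_j$, let $M$ be the linear map $M(s^1,\dots,s^r)=(M^1s^1,\dots,M^rs^r)$, so $M^\top(z^1,\dots,z^r)=((M^1)^\top z^1,\dots,(M^r)^\top z^r)$, let $A$ be $A^1,\dots,A^r$ stacked vertically, and $b=(b^1,\dots,b^r)$.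 For a set $Q$, $Q^+=\{y: y^\top z\ge0\ \forall z\in Q\}$; $\partial$ denotes boundary, $\operatorname{int}$ interior, $\operatorname{ri}$ relative interior, and $N_Q(s)=\{v:v^\top(z-s)\le0\ \forall z\in Q\}$ the normal cone to a closed convex cone $Q$ at $s\in Q$. The problems are $$(P)\ \min_x c^\top x\ \text{ s.t. } A^jx-b^j\in K_j\ \forall j\in J;\qquad (D)\ \max_y \sum_j (b^j)^\top y^j\ \text{ s.t. } \sum_j(A^j)^\top y^j=c,\ y^j\in K_j^+\ \forall j\in J;$$ $$(MP)\ \min_x c^\top x\ \text{ s.t. } M^j(A^jx-b^j)\in\mathcal{K}_j\ \forall j\in J;\qquad (MD)\ \max_z \sum_j (b^j)^\top (M^j)^\top z^j\ \text{ s.t. } \sum_j(A^j)^\top(M^j)^\top z^j=c,\ z^j\in\mathcal{K}_j^+\ \forall j\in J.$$ Strong duality for (P)-(D) means that both optimal solution sets are nonempty and the duality gap is zero. Let $S(C)$ be the set of $(x,y)$ with $A^jx-b^j\in K_j$, $y^j\in K_j^+$, $(y^j)^\top(A^jx-b^j)=0$ for all $j$, and $\sum_j(A^j)^\top y^j=c$. The four-partition of (P) is $B_P=\{j:\exists(x,y)\in S(C),\ A^jx-b^j\in\operatorname{int}K_j\}$, $N_P=\{j:\exists(x,y)\in S(C),\ y^j\in\operatorname{int}K_j^+\}$, $R^0_P=\{j:\exists(x,y)\in S(C),\ -y^j\in\operatorname{ri}N_{K_j}(A^jx-b^j)\}$, $R_P=R^0_P\setminus(B_P\cup N_P)$, $T_P=J\setminus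 R^0_P$. The four-partition $(B_{MP},N_{MP},R_{MP},T_{MP})$ of (MP) is defined in the same way from the data $M^jA^j$, $M^jb^j$, $\mathcal{K}_j$, i.e. with $A^jx-b^j$, $K_j$, $y^j$ replaced by $M^j(A^jx-b^j)$, $\mathcal{K}_j$, $z^j$, and $S(C)$ replaced by the set of $(x,z)$ with $M^j(A^jx-b^j)\in\mathcal{K}_j$, $z^j\in\mathcal{K}_j^+$, $(z^j)^\top M^j(A^jx-b^j)=0$ for all $j$, and $\sum_j(A^j)^\top(M^j)^\top z^j=c$. The strict complementarity condition holds for (P) if there is $(x,y)\in S(C)$ with $-y\in\operatorname{ri}N_K(Ax-b)$; for (MP), if there is a pair $(x,z)$ in the corresponding solution set with $-z\in\operatorname{ri}N_{\mathcal{K}}(M(Ax-b))$. *)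

theory Defs
  imports "HOL-Analysis.Analysis"
begin

text \<open>
  The blocks have different dimensions, so the space of block j is rendered as the coordinate
  subspace of \<open>real ^ 'q\<close> given by a set \<open>I j\<close> of coordinates; its dimension is
  \<open>card (I j)\<close>. As the finite type \<open>'q\<close> and the family \<open>I\<close> are arbitrary, every family of
  dimensions occurs. The product of the block spaces is a subspace of \<open>real ^ 'q ^ 'j\<close>, whose
  inner product is the sum of the blockwise ones.
\<close>

definition coord_space :: "'q set \<Rightarrow> (real ^ 'q::finite) set" where
  "coord_space I = {v. \<forall>i. i \<notin> I \<longrightarrow> v $ i = 0}"

definition prod_set :: "('j \<Rightarrow> (real ^ 'q) set) \<Rightarrow> (real ^ 'q::finite ^ 'j::finite) set" where
  "prod_set K = {s. \<forall>j. s $ j \<in> K j}"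

abbreviation prod_space :: "('j \<Rightarrow> 'q set) \<Rightarrow> (real ^ 'q::finite ^ 'j::finite) set" where
  "prod_space I \<equiv> prod_set (\<lambda>j. coord_space (I j))"

text \<open>A matrix with rows indexed by \<open>R\<close> and columns indexed by \<open>C\<close>, padded with zeros.\<close>

definition matrix_on :: "'r set \<Rightarrow> 'c set \<Rightarrow> real ^ 'c::finite ^ 'r::finite \<Rightarrow> bool" where
  "matrix_on R C X \<longleftrightarrow> (\<forall>i k. i \<notin> R \<or> k \<notin> C \<longrightarrow> X $ i $ k = 0)"

text \<open>
  Below, \<open>V\<close> is the ambient space. Interior, boundary, dual and normal cones are taken
  in \<open>V\<close>; closedness (\<open>V\<close> being a closed subspace) and the relative interior do not depend on it.
\<close>

definition interior_in :: "'a::euclidean_space set \<Rightarrow> 'a set \<Rightarrow> 'a set" where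
  "interior_in V Q = (top_of_set V) interior_of Q"

definition boundary_in :: "'a::euclidean_space set \<Rightarrow> 'a set \<Rightarrow> 'a set" where
  "boundary_in V Q = (top_of_set V) frontier_of Q"

definition closed_convex_regular_cone :: "'a::euclidean_space set \<Rightarrow> 'a set \<Rightarrow> bool" where
  "closed_convex_regular_cone V Q \<longleftrightarrow>
     Q \<subseteq> V \<and> closed Q \<and> convex Q \<and> cone Q \<and> interior_in V Q \<noteq> {} \<and> Q \<inter> uminus ` Q = {0}"

definition dual_cone :: "'a::euclidean_space set \<Rightarrow> 'a set \<Rightarrow> 'a set" where
  "dual_cone V Q = {y \<in> V. \<forall>z\<in>Q. 0 \<le> y \<bullet> z}"

definition normal_cone :: "'a::euclidean_space set \<Rightarrow> 'a set \<Rightarrow> 'a \<Rightarrow> 'a set" where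
  "normal_cone V Q s = {v \<in> V. \<forall>z\<in>Q. v \<bullet> (z - s) \<le> 0}"

definition block_map ::
  "('j \<Rightarrow> real ^ 'q ^ 'p) \<Rightarrow> real ^ 'q::finite ^ 'j::finite \<Rightarrow> real ^ 'p::finite ^ 'j" where
  "block_map M s = (\<chi> j. M j *v (s $ j))"

abbreviation block_map_transpose ::
  "('j \<Rightarrow> real ^ 'q ^ 'p) \<Rightarrow> real ^ 'p::finite ^ 'j::finite \<Rightarrow> real ^ 'q::finite ^ 'j" where
  "block_map_transpose M \<equiv> block_map (\<lambda>j. transpose (M j))"

text \<open>
  A conic program is given by coordinate sets \<open>I\<close>, matrices \<open>A\<close>, right-hand sides \<open>b\<close>,
  cones \<open>K\<close> and cost \<open>c\<close>. The definitions are used for the original program and for the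
  transformed one, whose data are \<open>M j ** A j\<close> and \<open>M j *v b j\<close>.
\<close>

definition slack ::
  "('j \<Rightarrow> real ^ 'n ^ 'q) \<Rightarrow> ('j \<Rightarrow> real ^ 'q) \<Rightarrow> real ^ 'n::finite
    \<Rightarrow> real ^ 'q::finite ^ 'j::finite" where
  "slack A b x = (\<chi> j. A j *v x - b j)"

definition primal_feasible ::
  "('j::finite \<Rightarrow> real ^ 'n ^ 'q) \<Rightarrow> ('j \<Rightarrow> real ^ 'q) \<Rightarrow> ('j \<Rightarrow> (real ^ 'q::finite) set)
    \<Rightarrow> (real ^ 'n::finite) set" where
  "primal_feasible A b K = {x. \<forall>j. slack A b x $ j \<in> K j}"

definition dual_feasible ::
  "('j \<Rightarrow> 'q set) \<Rightarrow> ('j \<Rightarrow> real ^ 'n ^ 'q) \<Rightarrow> ('j \<Rightarrow> (real ^ 'q) set) \<Rightarrow> real ^ 'n::finite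
    \<Rightarrow> (real ^ 'q::finite ^ 'j::finite) set" where
  "dual_feasible I A K c =
     {y. (\<Sum>j\<in>UNIV. transpose (A j) *v (y $ j)) = c \<and>
         (\<forall>j. y $ j \<in> dual_cone (coord_space (I j)) (K j))}"

definition dual_objective ::
  "('j \<Rightarrow> real ^ 'q) \<Rightarrow> real ^ 'q::finite ^ 'j::finite \<Rightarrow> real" where
  "dual_objective b y = (\<Sum>j\<in>UNIV. b j \<bullet> (y $ j))"

definition primal_optimal ::
  "('j::finite \<Rightarrow> real ^ 'n ^ 'q) \<Rightarrow> ('j \<Rightarrow> real ^ 'q) \<Rightarrow> ('j \<Rightarrow> (real ^ 'q::finite) set)
    \<Rightarrow> real ^ 'n::finite \<Rightarrow> (real ^ 'n) set" where
  "primal_optimal A b K c =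
     {x \<in> primal_feasible A b K. \<forall>x'\<in>primal_feasible A b K. c \<bullet> x \<le> c \<bullet> x'}"

definition dual_optimal ::
  "('j \<Rightarrow> 'q set) \<Rightarrow> ('j \<Rightarrow> real ^ 'n ^ 'q) \<Rightarrow> ('j \<Rightarrow> real ^ 'q) \<Rightarrow> ('j \<Rightarrow> (real ^ 'q) set)
    \<Rightarrow> real ^ 'n::finite \<Rightarrow> (real ^ 'q::finite ^ 'j::finite) set" where
  "dual_optimal I A b K c =
     {y \<in> dual_feasible I A K c. \<forall>y'\<in>dual_feasible I A K c. dual_objective b y' \<le> dual_objective b y}"

definition strong_duality ::
  "('j::finite \<Rightarrow> 'q set) \<Rightarrow> ('j \<Rightarrow> real ^ 'n ^ 'q) \<Rightarrow> ('j \<Rightarrow> real ^ 'q)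
    \<Rightarrow> ('j \<Rightarrow> (real ^ 'q::finite) set) \<Rightarrow> real ^ 'n::finite \<Rightarrow> bool" where
  "strong_duality I A b K c \<longleftrightarrow>
     primal_optimal A b K c \<noteq> {} \<and> dual_optimal I A b K c \<noteq> {} \<and>
     (INF x\<in>primal_feasible A b K. ereal (c \<bullet> x)) =
       (SUP y\<in>dual_feasible I A K c. ereal (dual_objective b y))"

definition compl_solutions ::
  "('j \<Rightarrow> 'q set) \<Rightarrow> ('j \<Rightarrow> real ^ 'n ^ 'q) \<Rightarrow> ('j \<Rightarrow> real ^ 'q) \<Rightarrow> ('j \<Rightarrow> (real ^ 'q) set)
    \<Rightarrow> real ^ 'n::finite \<Rightarrow> ((real ^ 'n) \<times> (real ^ 'q::finite ^ 'j::finite)) set" where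
  "compl_solutions I A b K c =
     {(x, y). (\<forall>j. slack A b x $ j \<in> K j \<and>
                   y $ j \<in> dual_cone (coord_space (I j)) (K j) \<and>
                   (y $ j) \<bullet> (slack A b x $ j) = 0) \<and>
              (\<Sum>j\<in>UNIV. transpose (A j) *v (y $ j)) = c}"

definition B_part ::
  "('j::finite \<Rightarrow> 'q set) \<Rightarrow> ('j \<Rightarrow> real ^ 'n ^ 'q) \<Rightarrow> ('j \<Rightarrow> real ^ 'q)
    \<Rightarrow> ('j \<Rightarrow> (real ^ 'q::finite) set) \<Rightarrow> real ^ 'n::finite \<Rightarrow> 'j set" where
  "B_part I A b K c =
     {j. \<exists>(x, y)\<in>compl_solutions I A b K c.
           slack A b x $ j \<in> interior_in (coord_space (I j)) (K j)}"

definition N_part ::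
  "('j::finite \<Rightarrow> 'q set) \<Rightarrow> ('j \<Rightarrow> real ^ 'n ^ 'q) \<Rightarrow> ('j \<Rightarrow> real ^ 'q)
    \<Rightarrow> ('j \<Rightarrow> (real ^ 'q::finite) set) \<Rightarrow> real ^ 'n::finite \<Rightarrow> 'j set" where
  "N_part I A b K c =
     {j. \<exists>(x, y)\<in>compl_solutions I A b K c.
           y $ j \<in> interior_in (coord_space (I j)) (dual_cone (coord_space (I j)) (K j))}"

definition R0_part ::
  "('j::finite \<Rightarrow> 'q set) \<Rightarrow> ('j \<Rightarrow> real ^ 'n ^ 'q) \<Rightarrow> ('j \<Rightarrow> real ^ 'q)
    \<Rightarrow> ('j \<Rightarrow> (real ^ 'q::finite) set) \<Rightarrow> real ^ 'n::finite \<Rightarrow> 'j set" where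
  "R0_part I A b K c =
     {j. \<exists>(x, y)\<in>compl_solutions I A b K c.
           - (y $ j) \<in> rel_interior (normal_cone (coord_space (I j)) (K j) (slack A b x $ j))}"

definition R_part ::
  "('j::finite \<Rightarrow> 'q set) \<Rightarrow> ('j \<Rightarrow> real ^ 'n ^ 'q) \<Rightarrow> ('j \<Rightarrow> real ^ 'q)
    \<Rightarrow> ('j \<Rightarrow> (real ^ 'q::finite) set) \<Rightarrow> real ^ 'n::finite \<Rightarrow> 'j set" where
  "R_part I A b K c = R0_part I A b K c - (B_part I A b K c \<union> N_part I A b K c)"

definition T_part ::
  "('j::finite \<Rightarrow> 'q set) \<Rightarrow> ('j \<Rightarrow> real ^ 'n ^ 'q) \<Rightarrow> ('j \<Rightarrow> real ^ 'q)
    \<Rightarrow> ('j \<Rightarrow> (real ^ 'q::finite) set) \<Rightarrow> real ^ 'n::finite \<Rightarrow> 'j set" where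
  "T_part I A b K c = UNIV - R0_part I A b K c"

definition strict_complementarity ::
  "('j::finite \<Rightarrow> 'q set) \<Rightarrow> ('j \<Rightarrow> real ^ 'n ^ 'q) \<Rightarrow> ('j \<Rightarrow> real ^ 'q)
    \<Rightarrow> ('j \<Rightarrow> (real ^ 'q::finite) set) \<Rightarrow> real ^ 'n::finite \<Rightarrow> bool" where
  "strict_complementarity I A b K c \<longleftrightarrow>
     (\<exists>(x, y)\<in>compl_solutions I A b K c.
        - y \<in> rel_interior (normal_cone (prod_space I) (prod_set K) (slack A b x)))"

end

theory Submission
  imports Defs
begin

text \<open>
  The theorem rests on the identity \<open>K\<^sup>+ = M\<^sup>T L\<^sup>+\<close> for the product cones (and hence for each block).
  As \<open>K\<close> is the preimage of \<open>L\<close> under \<open>M\<close>, the inclusion of \<open>M\<^sup>T L\<^sup>+\<close> in \<open>K\<^sup>+\<close> is immediate, and a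
  vector that separates a point of \<open>K\<^sup>+\<close> from the closed convex cone \<open>M\<^sup>T L\<^sup>+\<close> would be mapped by \<open>M\<close>
  into \<open>L\<^sup>+\<^sup>+ = L\<close>, so would lie in \<open>K\<close>, which is absurd (\<open>dual_cone_preimage\<close>).

  Since \<open>(M\<^sup>T z) \<bullet> s = z \<bullet> (M s)\<close>, the map \<open>(x, z) \<mapsto> (x, M\<^sup>T z)\<close> then carries the complementary
  solutions of the transformed program onto those of the original one, and
  \<open>N\<^sub>K(s) = M\<^sup>T N\<^sub>L(M s)\<close> for \<open>s \<in> K\<close>. Relative interiors of convex sets commute with linear maps, so
  \<open>ri N\<^sub>K(s) = M\<^sup>T ri N\<^sub>L(M s)\<close>; this settles \<open>R\<^sup>0\<close>, its complement \<open>T\<close> and, read in the product space, strict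
  complementarity. Pointedness makes the dual cones full-dimensional, so their interiors are their
  relative interiors and \<open>int K\<^sup>+ = M\<^sup>T int L\<^sup>+\<close>, which settles \<open>N\<close>. For \<open>B\<close>, the hypothesis on
  boundaries says exactly that a point \<open>s\<close> of a block of \<open>K\<close> is interior if and only if its image
  is. The class \<open>R\<close> is determined by \<open>R\<^sup>0\<close>, \<open>B\<close> and \<open>N\<close>.

  In \<open>N\<close> and \<open>R\<^sup>0\<close> only one block of the dual vector is prescribed; as \<open>M\<^sup>T\<close> acts blockwise, a suitable
  preimage of that block can be completed by arbitrary preimages of the others
  (\<open>dual_block_transform\<close>).
\<close>

section \<open>Dual cones in a subspace\<close>

lemma cone_separation:
  fixes Q :: "'a::euclidean_space set"
  assumes "subspace V" "Q \<subseteq> V" "closed Q" "convex Q" "cone Q" "0 \<in> Q" "y \<in> V" "y \<notin> Q"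
  obtains a where "a \<in> V" "a \<bullet> y < 0" "\<And>q. q \<in> Q \<Longrightarrow> 0 \<le> a \<bullet> q"
proof -
  obtain a \<beta> where a: "a \<bullet> y < \<beta>" "\<And>q. q \<in> Q \<Longrightarrow> \<beta> < a \<bullet> q"
    using separating_hyperplane_closed_point[OF \<open>convex Q\<close> \<open>closed Q\<close> \<open>y \<notin> Q\<close>] by blast
  have neg: "\<beta> < 0" using a(2)[OF \<open>0 \<in> Q\<close>] by simp
  have nonneg: "0 \<le> a \<bullet> q" if "q \<in> Q" for q
  proof (rule ccontr)
    assume "\<not> 0 \<le> a \<bullet> q"
    \<comment> \<open>Rescaling \<open>q\<close> inside the cone would put it on the separating hyperplane.\<close>
    then have "0 \<le> \<beta> / (a \<bullet> q)" and eq: "a \<bullet> ((\<beta> / (a \<bullet> q)) *\<^sub>R q) = \<beta>"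
      using neg by (auto simp: divide_simps)
    then have "(\<beta> / (a \<bullet> q)) *\<^sub>R q \<in> Q" using \<open>cone Q\<close> that by (auto simp: cone_def)
    from a(2)[OF this] eq show False by simp
  qed
  \<comment> \<open>Only the component of \<open>a\<close> in \<open>V\<close> matters, since \<open>Q\<close> and \<open>y\<close> lie in \<open>V\<close>.\<close>
  obtain u w where u: "u \<in> span V" and w: "\<And>v. v \<in> span V \<Longrightarrow> orthogonal w v" and auw: "a = u + w"
    using orthogonal_subspace_decomp_exists[of V a] by metis
  have eq: "a \<bullet> v = u \<bullet> v" if "v \<in> V" for v
    using w[OF span_base[OF that]] by (simp add: auw orthogonal_def inner_add_left)
  show ?thesis
  proof
    show "u \<in> V" using u \<open>subspace V\<close> span_eq_iff by blast
    show "u \<bullet> y < 0" using a(1) neg eq[OF \<open>y \<in> V\<close>] by simp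
    show "0 \<le> u \<bullet> q" if "q \<in> Q" for q using nonneg[OF that] eq \<open>Q \<subseteq> V\<close> that by auto
  qed
qed

lemma dual_cone_bidual:
  assumes "subspace V" "Q \<subseteq> V" "closed Q" "convex Q" "cone Q" "0 \<in> Q"
  shows "dual_cone V (dual_cone V Q) = Q"
proof
  show "Q \<subseteq> dual_cone V (dual_cone V Q)"
    using \<open>Q \<subseteq> V\<close> by (auto simp: dual_cone_def inner_commute)
  show "dual_cone V (dual_cone V Q) \<subseteq> Q"
  proof (rule ccontr)
    assume "\<not> ?thesis"
    then obtain y where y: "y \<in> dual_cone V (dual_cone V Q)" "y \<notin> Q" by blast
    then have "y \<in> V" by (simp add: dual_cone_def)
    then obtain a where "a \<in> V" "a \<bullet> y < 0" "\<And>q. q \<in> Q \<Longrightarrow> 0 \<le> a \<bullet> q"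
      using cone_separation[OF assms _ y(2)] by blast
    then have "a \<in> dual_cone V Q" by (simp add: dual_cone_def)
    then have "0 \<le> y \<bullet> a" using y(1) by (simp add: dual_cone_def)
    with \<open>a \<bullet> y < 0\<close> show False by (simp add: inner_commute)
  qed
qed

lemma convex_cone_dual_cone:
  assumes "subspace V"
  shows "convex (dual_cone V Q)" "cone (dual_cone V Q)" "0 \<in> dual_cone V Q"
proof -
  show "convex (dual_cone V Q)"
    using assms unfolding convex_def dual_cone_def
    by (auto simp: inner_add_left subspace_add subspace_scale)
  show "cone (dual_cone V Q)"
    using assms unfolding cone_def dual_cone_def by (auto simp: subspace_scale)
  show "0 \<in> dual_cone V Q" using assms by (simp add: dual_cone_def subspace_0)
qed

text \<open>
  If the dual cone spanned less than \<open>V\<close>, a nonzero vector of \<open>V\<close> orthogonal to it would lie,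
  together with its negative, in the bidual, that is in the cone itself.
\<close>

lemma interior_dual_cone_eq_rel_interior:
  assumes V: "subspace V" and Q: "closed_convex_regular_cone V Q"
  shows "interior_in V (dual_cone V Q) = rel_interior (dual_cone V Q)"
proof -
  let ?D = "dual_cone V Q"
  have Q0: "0 \<in> Q" and pointed: "Q \<inter> uminus ` Q = {0}"
    using Q by (auto simp: closed_convex_regular_cone_def)
  have bidual: "dual_cone V ?D = Q"
    using dual_cone_bidual[OF V] Q Q0 by (simp add: closed_convex_regular_cone_def)
  have sub: "?D \<subseteq> V" by (auto simp: dual_cone_def)
  have "span ?D = V"
  proof (rule ccontr)
    assume "span ?D \<noteq> V"
    then have "span ?D \<subset> span V"
      using span_mono[OF sub] V span_eq_iff by blast
    then obtain w where w: "w \<noteq> 0" "w \<in> span V" "\<And>d. d \<in> span ?D \<Longrightarrow> orthogonal w d"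
      using orthogonal_to_subspace_exists_gen by metis
    then have "w \<in> V" using V span_eq_iff by blast
    moreover have "w \<bullet> d = 0" if "d \<in> ?D" for d
      using w(3)[OF span_base[OF that]] by (simp add: orthogonal_def)
    ultimately have "w \<in> dual_cone V ?D" "- w \<in> dual_cone V ?D"
      using V unfolding dual_cone_def[of V ?D] by (auto simp: subspace_neg)
    then have "w \<in> Q \<inter> uminus ` Q" unfolding bidual by force
    with pointed w(1) show False by blast
  qed
  then have "affine hull ?D = V"
    using affine_hull_span_0 hull_inc[OF convex_cone_dual_cone(3)[OF V]] by blast
  then show ?thesis
    unfolding interior_in_def interior_of_def rel_interior_def by auto
qed

text \<open>
  The nontrivial inclusion is Farkas' lemma for \<open>g ` L\<^sup>+\<close>: a separating vector \<open>a\<close> is nonnegative on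
  \<open>g ` L\<^sup>+\<close>, which by adjointness says that \<open>f a\<close> lies in \<open>L\<^sup>+\<^sup>+ = L\<close>, so \<open>a \<in> K\<close>.
\<close>

lemma dual_cone_preimage:
  fixes f :: "'a::euclidean_space \<Rightarrow> 'b::euclidean_space"
  assumes V: "subspace V" and W: "subspace W"
    and f: "\<And>s. s \<in> V \<Longrightarrow> f s \<in> W"
    and g: "linear g" "\<And>z. z \<in> W \<Longrightarrow> g z \<in> V"
    and adj: "\<And>s z. s \<bullet> g z = f s \<bullet> z"
    and L: "L \<subseteq> W" "closed L" "convex L" "cone L" "0 \<in> L"
    and K: "K \<subseteq> V" "\<And>s. s \<in> V \<Longrightarrow> s \<in> K \<longleftrightarrow> f s \<in> L"
    and closed: "closed (g ` dual_cone W L)"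
  shows "dual_cone V K = g ` dual_cone W L"
proof
  show "g ` dual_cone W L \<subseteq> dual_cone V K"
  proof (clarsimp simp: dual_cone_def g(2))
    fix z s assume z: "z \<in> W" "\<forall>q\<in>L. 0 \<le> z \<bullet> q" and "s \<in> K"
    then have "f s \<in> L" using K by blast
    then show "0 \<le> g z \<bullet> s" using z adj[of s z] by (metis inner_commute)
  qed
  show "dual_cone V K \<subseteq> g ` dual_cone W L"
  proof (rule ccontr)
    assume "\<not> ?thesis"
    then obtain y where y: "y \<in> dual_cone V K" "y \<notin> g ` dual_cone W L" by blast
    note D = convex_cone_dual_cone[OF W, of L]
    have "g ` dual_cone W L \<subseteq> V" using g(2) by (auto simp: dual_cone_def)
    moreover have "0 \<in> g ` dual_cone W L"
      using D(3) linear_0[OF g(1)] by force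
    moreover have "cone (g ` dual_cone W L)"
      using D(2) unfolding cone_def by (auto simp: linear_scale[OF g(1), symmetric])
    moreover have "y \<in> V" using y(1) by (simp add: dual_cone_def)
    ultimately obtain a where a: "a \<in> V" "a \<bullet> y < 0" "\<And>q. q \<in> g ` dual_cone W L \<Longrightarrow> 0 \<le> a \<bullet> q"
      using cone_separation[OF V _ closed convex_linear_image[OF g(1) D(1)] _ _ _ y(2)] by blast
    then have "f a \<in> dual_cone W (dual_cone W L)"
      using f adj[of a, symmetric] by (simp add: dual_cone_def[of W "dual_cone W L"])
    then have "a \<in> K" using dual_cone_bidual[OF W L] K(2) a(1) by simp
    then show False using y(1) a(2) by (auto simp: dual_cone_def inner_commute)
  qed
qed

text \<open>Testing the inequality of the normal cone at \<open>0\<close> and at \<open>2 s\<close> yields orthogonality to \<open>s\<close>.\<close>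

lemma normal_cone_cone:
  assumes "subspace V" "cone Q" "s \<in> Q"
  shows "normal_cone V Q s = {v. - v \<in> dual_cone V Q \<and> v \<bullet> s = 0}"
proof (intro equalityI subsetI CollectI)
  fix v assume v: "v \<in> normal_cone V Q s"
  have "0 *\<^sub>R s \<in> Q" "2 *\<^sub>R s \<in> Q"
    using assms(2,3) unfolding cone_def by (blast intro: order_refl zero_le_numeral)+
  then have "v \<bullet> (0 *\<^sub>R s - s) \<le> 0" "v \<bullet> (2 *\<^sub>R s - s) \<le> 0"
    using v unfolding normal_cone_def by blast+
  then have "v \<bullet> s = 0" by (simp add: scaleR_2)
  then show "- v \<in> dual_cone V Q \<and> v \<bullet> s = 0"
    using v assms(1) by (auto simp: normal_cone_def dual_cone_def inner_diff_right subspace_neg)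
next
  fix v assume "v \<in> {v. - v \<in> dual_cone V Q \<and> v \<bullet> s = 0}"
  then show "v \<in> normal_cone V Q s"
    using assms(1) subspace_neg[of V "- v"]
    by (auto simp: normal_cone_def dual_cone_def inner_diff_right)
qed

text \<open>
  By \<open>normal_cone_cone\<close> a normal cone is the part of the negated dual cone orthogonal to the base
  point, and adjointness matches orthogonality to \<open>s\<close> with orthogonality to \<open>f s\<close>.
\<close>

lemma rel_interior_normal_cone_preimage:
  fixes f :: "'a::euclidean_space \<Rightarrow> 'b::euclidean_space"
  assumes V: "subspace V" and W: "subspace W" and g: "linear g"
    and adj: "\<And>s z. s \<bullet> g z = f s \<bullet> z"
    and cones: "cone K" "cone L" and s: "s \<in> K" "f s \<in> L"
    and dual: "dual_cone V K = g ` dual_cone W L"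
  shows "rel_interior (normal_cone V K s) = g ` rel_interior (normal_cone W L (f s))"
proof -
  have orth: "g z \<bullet> s = z \<bullet> f s" for z using adj[of s z] by (metis inner_commute)
  have "normal_cone V K s = g ` normal_cone W L (f s)"
  proof (intro equalityI subsetI)
    fix v assume "v \<in> normal_cone V K s"
    then have v: "- v \<in> dual_cone V K" "v \<bullet> s = 0"
      using normal_cone_cone[OF V cones(1) s(1)] by auto
    then obtain z where z: "z \<in> dual_cone W L" "- v = g z" using dual by blast
    then have "v = g (- z)" using linear_neg[OF g, of z] by (metis minus_minus)
    moreover have "(- z) \<bullet> f s = 0" using orth[of "- z"] calculation v(2) by simp
    ultimately show "v \<in> g ` normal_cone W L (f s)"
      using z(1) normal_cone_cone[OF W cones(2) s(2)] by auto
  next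
    fix v assume "v \<in> g ` normal_cone W L (f s)"
    then obtain z where z: "v = g z" "- z \<in> dual_cone W L" "z \<bullet> f s = 0"
      using normal_cone_cone[OF W cones(2) s(2)] by auto
    then have "- v \<in> dual_cone V K" using dual linear_neg[OF g, of z] by force
    then show "v \<in> normal_cone V K s"
      using normal_cone_cone[OF V cones(1) s(1)] orth[of z] z by auto
  qed
  moreover have "convex (normal_cone W L (f s))"
    using W unfolding convex_def normal_cone_def
    by (auto simp: inner_add_left subspace_add subspace_scale mult_nonneg_nonpos add_nonpos_nonpos)
  ultimately show ?thesis
    using rel_interior_convex_linear_image[OF g] by simp
qed

lemma boundary_in_iff_not_interior_in:
  assumes "s \<in> Q" "Q \<subseteq> V"
  shows "s \<in> boundary_in V Q \<longleftrightarrow> s \<notin> interior_in V Q"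
  using assms closure_of_subset[of Q "top_of_set V"]
  by (auto simp: boundary_in_def interior_in_def frontier_of_def)

section \<open>Products of blocks\<close>

lemma subspace_coord_space: "subspace (coord_space I)"
  by (auto simp: coord_space_def subspace_def)

lemma subspace_prod_set: "(\<And>j. subspace (V j)) \<Longrightarrow> subspace (prod_set V)"
  by (auto simp: prod_set_def subspace_def)

lemma closed_prod_set:
  assumes "\<And>j. closed (Q j)"
  shows "closed (prod_set Q)"
proof -
  have "prod_set Q = (\<Inter>j. (\<lambda>s. s $ j) -` Q j)" by (auto simp: prod_set_def)
  then show ?thesis
    using assms by (auto intro!: closed_INT closed_vimage continuous_intros)
qed

lemma convex_prod_set: "(\<And>j. convex (Q j)) \<Longrightarrow> convex (prod_set Q)"
  unfolding convex_def prod_set_def by simp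

lemma cone_prod_set: "(\<And>j. cone (Q j)) \<Longrightarrow> cone (prod_set Q)"
  unfolding cone_def prod_set_def by simp

lemma inner_blocks:
  fixes s t :: "real ^ 'q::finite ^ 'j::finite"
  shows "s \<bullet> t = (\<Sum>j\<in>UNIV. s $ j \<bullet> t $ j)"
  by (rule inner_vec_def)

lemma dual_cone_prod_set:
  assumes "\<And>j. 0 \<in> Q j"
  shows "dual_cone (prod_set V) (prod_set Q) = prod_set (\<lambda>j. dual_cone (V j) (Q j))"
proof (intro equalityI subsetI)
  fix y assume y: "y \<in> dual_cone (prod_set V) (prod_set Q)"
  have "0 \<le> y $ j \<bullet> q" if "q \<in> Q j" for j q
  proof -
    have "axis j q \<in> prod_set Q" using assms that by (auto simp: prod_set_def axis_def)
    then have "0 \<le> y \<bullet> axis j q" using y by (simp add: dual_cone_def)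
    then show ?thesis by (simp add: inner_axis)
  qed
  then show "y \<in> prod_set (\<lambda>j. dual_cone (V j) (Q j))"
    using y by (auto simp: dual_cone_def prod_set_def)
next
  fix y assume "y \<in> prod_set (\<lambda>j. dual_cone (V j) (Q j))"
  then show "y \<in> dual_cone (prod_set V) (prod_set Q)"
    by (auto simp: dual_cone_def prod_set_def inner_blocks intro!: sum_nonneg)
qed

lemma linear_block_map: "linear (block_map M)"
  by (rule linearI) (simp_all add: block_map_def vec_eq_iff matrix_vector_right_distrib
      matrix_vector_mult_scaleR)

lemma inner_transpose:
  fixes X :: "real ^ 'q::finite ^ 'p::finite"
  shows "s \<bullet> (transpose X *v z) = (X *v s) \<bullet> z"
  by (metis dot_lmul_matrix transpose_matrix_vector inner_commute)

lemma inner_block_map_transpose: "s \<bullet> block_map_transpose M z = block_map M s \<bullet> z"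
  by (simp add: inner_blocks block_map_def inner_transpose del: transpose_matrix_vector)

lemma matrix_on_vector_mult_coord_space: "matrix_on R C X \<Longrightarrow> X *v v \<in> coord_space R"
  by (simp add: matrix_on_def coord_space_def matrix_vector_mult_def)

lemma matrix_on_transpose: "matrix_on R C X \<Longrightarrow> matrix_on C R (transpose X)"
  by (auto simp: matrix_on_def transpose_def)

text \<open>
  Closedness is assumed for the image of the product of the dual cones, so the identity is available
  in the product space first. It descends to block \<open>j\<close> by extending a vector of that block with zeros.
\<close>

lemma dual_cone_block_of_prod:
  assumes K: "\<And>j. 0 \<in> K j" and L: "\<And>j. 0 \<in> L j"
    and dual: "dual_cone (prod_space I) (prod_set K)
      = block_map_transpose M ` dual_cone (prod_space P) (prod_set L)"
  shows "dual_cone (coord_space (I j)) (K j)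
    = (\<lambda>z. transpose (M j) *v z) ` dual_cone (coord_space (P j)) (L j)"
proof (intro equalityI subsetI)
  fix y assume "y \<in> dual_cone (coord_space (I j)) (K j)"
  then have "axis j y \<in> prod_set (\<lambda>j. dual_cone (coord_space (I j)) (K j))"
    using convex_cone_dual_cone(3)[OF subspace_coord_space] by (auto simp: prod_set_def axis_def)
  then obtain z where z: "z \<in> prod_set (\<lambda>j. dual_cone (coord_space (P j)) (L j))"
      "axis j y = block_map_transpose M z"
    using dual unfolding dual_cone_prod_set[of K, OF K] dual_cone_prod_set[of L, OF L] by auto
  then have "y = transpose (M j) *v (z $ j)"
    by (metis axis_nth block_map_def vec_lambda_beta)
  then show "y \<in> (\<lambda>z. transpose (M j) *v z) ` dual_cone (coord_space (P j)) (L j)"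
    using z(1) by (auto simp: prod_set_def)
next
  fix y assume "y \<in> (\<lambda>z. transpose (M j) *v z) ` dual_cone (coord_space (P j)) (L j)"
  then obtain z where z: "z \<in> dual_cone (coord_space (P j)) (L j)" "y = transpose (M j) *v z"
    by blast
  then have "axis j z \<in> prod_set (\<lambda>j. dual_cone (coord_space (P j)) (L j))"
    using convex_cone_dual_cone(3)[OF subspace_coord_space] by (auto simp: prod_set_def axis_def)
  then have "block_map_transpose M (axis j z) \<in> prod_set (\<lambda>j. dual_cone (coord_space (I j)) (K j))"
    using dual unfolding dual_cone_prod_set[of K, OF K] dual_cone_prod_set[of L, OF L] by auto
  then show "y \<in> dual_cone (coord_space (I j)) (K j)"
    using z(2) by (auto simp: prod_set_def block_map_def dest: spec[of _ j])
qed

section \<open>Complementary solutions of the transformed program\<close>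

lemma slack_transform:
  "slack (\<lambda>j. M j ** A j) (\<lambda>j. M j *v b j) x = block_map M (slack A b x)"
  by (simp add: slack_def block_map_def vec_eq_iff matrix_vector_mul_assoc
      matrix_vector_mult_diff_distrib)

lemma compl_solutions_transform:
  fixes M :: "'j::finite \<Rightarrow> real ^ 'q::finite ^ 'p::finite"
  assumes K_iff_L: "\<And>j s. s \<in> coord_space (I j) \<Longrightarrow> s \<in> K j \<longleftrightarrow> M j *v s \<in> L j"
    and slack: "slack A b x \<in> prod_space I"
    and dual: "\<And>j. dual_cone (coord_space (I j)) (K j)
      = (\<lambda>z. transpose (M j) *v z) ` dual_cone (coord_space (P j)) (L j)"
  shows "(x, z) \<in> compl_solutions P (\<lambda>j. M j ** A j) (\<lambda>j. M j *v b j) L c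
    \<longleftrightarrow> (x, block_map_transpose M z) \<in> compl_solutions I A b K c
        \<and> z \<in> prod_set (\<lambda>j. dual_cone (coord_space (P j)) (L j))"
proof -
  have "slack A b x $ j \<in> K j \<longleftrightarrow> M j *v slack A b x $ j \<in> L j" for j
    using K_iff_L slack by (simp add: prod_set_def)
  moreover have "(transpose (M j) *v z $ j) \<bullet> slack A b x $ j = z $ j \<bullet> (M j *v slack A b x $ j)" for j
    by (metis inner_transpose inner_commute)
  moreover have "transpose (M j ** A j) *v z $ j = transpose (A j) *v (transpose (M j) *v z $ j)" for j
    by (simp only: matrix_transpose_mul matrix_vector_mul_assoc)
  ultimately show ?thesis
    unfolding compl_solutions_def slack_transform
    by (auto simp: prod_set_def block_map_def dual)
qed

text \<open>
  The classes \<open>N\<close> and \<open>R\<^sup>0\<close> both prescribe a set for block \<open>j\<close> of the dual vector: \<open>X s\<close> in the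
  original program and \<open>Y t\<close> in the transformed one, where \<open>s\<close> and \<open>t\<close> are the slacks of that block
  (for \<open>N\<close> the sets are constant). Complementarity and dual feasibility separate into blocks, and
  the remaining equation depends on \<open>z\<close> only through \<open>M\<^sup>T z\<close>, so the preimage of block \<open>j\<close> can be
  chosen independently of the others.
\<close>

lemma dual_block_transform:
  fixes M :: "'j::finite \<Rightarrow> real ^ 'q::finite ^ 'p::finite"
  assumes K_iff_L: "\<And>j s. s \<in> coord_space (I j) \<Longrightarrow> s \<in> K j \<longleftrightarrow> M j *v s \<in> L j"
    and slack: "\<And>x. slack A b x \<in> prod_space I"
    and dual: "\<And>j. dual_cone (coord_space (I j)) (K j)
      = (\<lambda>z. transpose (M j) *v z) ` dual_cone (coord_space (P j)) (L j)"
    and XY: "\<And>s. s \<in> coord_space (I j) \<Longrightarrow> s \<in> K j \<Longrightarrow> X s = (\<lambda>z. transpose (M j) *v z) ` Y (M j *v s)"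
    and Y: "\<And>t. t \<in> L j \<Longrightarrow> Y t \<subseteq> dual_cone (coord_space (P j)) (L j)"
  shows "(\<exists>(x, y)\<in>compl_solutions I A b K c. y $ j \<in> X (slack A b x $ j))
    \<longleftrightarrow> (\<exists>(x, z)\<in>compl_solutions P (\<lambda>j. M j ** A j) (\<lambda>j. M j *v b j) L c.
          z $ j \<in> Y (slack (\<lambda>j. M j ** A j) (\<lambda>j. M j *v b j) x $ j))"
    (is "?l \<longleftrightarrow> ?r")
proof
  assume ?l
  then obtain x y where xy: "(x, y) \<in> compl_solutions I A b K c" "y $ j \<in> X (slack A b x $ j)"
    by blast
  have sI: "slack A b x $ j \<in> coord_space (I j)" using slack by (simp add: prod_set_def)
  have sK: "slack A b x $ j \<in> K j" and y: "\<And>i. y $ i \<in> dual_cone (coord_space (I i)) (K i)"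
    using xy(1) by (auto simp: compl_solutions_def)
  have sL: "M j *v slack A b x $ j \<in> L j" using K_iff_L[OF sI] sK by simp
  obtain w where w: "w \<in> Y (M j *v slack A b x $ j)" "y $ j = transpose (M j) *v w"
    using xy(2) XY[OF sI sK] by blast
  have "\<forall>i. \<exists>z. z \<in> dual_cone (coord_space (P i)) (L i) \<and> y $ i = transpose (M i) *v z"
    using y dual by blast
  then obtain v where v: "\<And>i. v i \<in> dual_cone (coord_space (P i)) (L i)"
      "\<And>i. y $ i = transpose (M i) *v v i" by metis
  define z where "z = (\<chi> i. if i = j then w else v i)"
  have "block_map_transpose M z = y"
    using v(2) w(2) by (simp add: vec_eq_iff block_map_def z_def)
  moreover have "z \<in> prod_set (\<lambda>j. dual_cone (coord_space (P j)) (L j))"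
    using v(1) w(1) Y[OF sL] by (auto simp: prod_set_def z_def)
  ultimately have "(x, z) \<in> compl_solutions P (\<lambda>j. M j ** A j) (\<lambda>j. M j *v b j) L c"
    using compl_solutions_transform[OF K_iff_L slack dual] xy(1) by simp
  moreover have "z $ j \<in> Y (slack (\<lambda>j. M j ** A j) (\<lambda>j. M j *v b j) x $ j)"
    using w(1) by (simp add: z_def slack_transform block_map_def)
  ultimately show ?r by blast
next
  assume ?r
  then obtain x z where xz: "(x, z) \<in> compl_solutions P (\<lambda>j. M j ** A j) (\<lambda>j. M j *v b j) L c"
      "z $ j \<in> Y (M j *v (slack A b x $ j))"
    by (auto simp: slack_transform block_map_def)
  have sol: "(x, block_map_transpose M z) \<in> compl_solutions I A b K c"
    using compl_solutions_transform[OF K_iff_L slack dual] xz(1) by blast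
  have sI: "slack A b x $ j \<in> coord_space (I j)" using slack by (simp add: prod_set_def)
  have sK: "slack A b x $ j \<in> K j" using sol by (simp add: compl_solutions_def)
  have "block_map_transpose M z $ j \<in> X (slack A b x $ j)"
    unfolding XY[OF sI sK] using xz(2) by (simp add: block_map_def)
  with sol show ?l by blast
qed

section \<open>Coincidence of the partitions\<close>

theorem proposition9:
  fixes I :: "'j::finite \<Rightarrow> 'q::finite set"
    and P :: "'j \<Rightarrow> 'p::finite set"
    and A :: "'j \<Rightarrow> real ^ 'n::finite ^ 'q"
    and b :: "'j \<Rightarrow> real ^ 'q"
    and c :: "real ^ 'n"
    and M :: "'j \<Rightarrow> real ^ 'q ^ 'p"
    and K :: "'j \<Rightarrow> (real ^ 'q) set"
    and L :: "'j \<Rightarrow> (real ^ 'p) set"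
  assumes A_dims: "\<And>j. matrix_on (I j) UNIV (A j)"
    and b_dims: "\<And>j. b j \<in> coord_space (I j)"
    and M_dims: "\<And>j. matrix_on (P j) (I j) (M j)"
    and K_cone: "\<And>j. closed_convex_regular_cone (coord_space (I j)) (K j)"
    and L_cone: "\<And>j. closed_convex_regular_cone (coord_space (P j)) (L j)"
    and K_iff_L: "\<And>j s. s \<in> coord_space (I j) \<Longrightarrow> s \<in> K j \<longleftrightarrow> M j *v s \<in> L j"
    and strong: "strong_duality I A b K c"
    and M_closed: "closed (block_map_transpose M ` dual_cone (prod_space P) (prod_set L))"
    and M_inj: "inj_on (block_map M) (prod_space I)"
    and M_boundary: "\<And>j s. s \<in> K j \<Longrightarrow>
      M j *v s \<in> boundary_in (coord_space (P j)) (L j) \<longleftrightarrow> s \<in> boundary_in (coord_space (I j)) (K j)"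
  shows "(B_part I A b K c = B_part P (\<lambda>j. M j ** A j) (\<lambda>j. M j *v b j) L c
        \<and> N_part I A b K c = N_part P (\<lambda>j. M j ** A j) (\<lambda>j. M j *v b j) L c
        \<and> R_part I A b K c = R_part P (\<lambda>j. M j ** A j) (\<lambda>j. M j *v b j) L c
        \<and> T_part I A b K c = T_part P (\<lambda>j. M j ** A j) (\<lambda>j. M j *v b j) L c)
    \<and> (strict_complementarity I A b K c
        \<longleftrightarrow> strict_complementarity P (\<lambda>j. M j ** A j) (\<lambda>j. M j *v b j) L c)"
proof -
  let ?A = "\<lambda>j. M j ** A j" and ?b = "\<lambda>j. M j *v b j"
  let ?S = "compl_solutions I A b K c" and ?S' = "compl_solutions P ?A ?b L c"
  let ?VK = "\<lambda>j. coord_space (I j)" and ?VL = "\<lambda>j. coord_space (P j)"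
  have K: "K j \<subseteq> ?VK j" "cone (K j)" "0 \<in> K j" for j
    using K_cone[of j] by (auto simp: closed_convex_regular_cone_def)
  have L: "L j \<subseteq> ?VL j" "closed (L j)" "convex (L j)" "cone (L j)" "0 \<in> L j" for j
    using L_cone[of j] by (auto simp: closed_convex_regular_cone_def)
  have spaces: "subspace (prod_space I)" "subspace (prod_space P)"
    by (simp_all add: subspace_prod_set subspace_coord_space)
  have slack: "slack A b x \<in> prod_space I" for x
    using A_dims b_dims
    by (auto simp: prod_set_def slack_def intro!: subspace_diff subspace_coord_space
        matrix_on_vector_mult_coord_space)

  have prod_dual: "dual_cone (prod_space I) (prod_set K)
      = block_map_transpose M ` dual_cone (prod_space P) (prod_set L)"
  proof (rule dual_cone_preimage[OF spaces _ linear_block_map _ inner_block_map_transpose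
        _ _ _ _ _ _ _ M_closed])
    show "block_map M s \<in> prod_space P" for s
      using M_dims by (auto simp: prod_set_def block_map_def intro: matrix_on_vector_mult_coord_space)
    show "block_map_transpose M z \<in> prod_space I" for z
      using M_dims by (auto simp: prod_set_def block_map_def simp del: transpose_matrix_vector
          intro: matrix_on_vector_mult_coord_space matrix_on_transpose)
    show "prod_set L \<subseteq> prod_space P" "prod_set K \<subseteq> prod_space I" "0 \<in> prod_set L"
      using K(1) L(1,5) by (auto simp: prod_set_def subset_iff)
    show "closed (prod_set L)" "convex (prod_set L)" "cone (prod_set L)"
      using L by (simp_all add: closed_prod_set convex_prod_set cone_prod_set)
    show "s \<in> prod_set K \<longleftrightarrow> block_map M s \<in> prod_set L" if "s \<in> prod_space I" for s
      using that K_iff_L by (simp add: prod_set_def block_map_def)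
  qed
  note dual = dual_cone_block_of_prod[OF K(3) L(5) prod_dual]
  note sol = compl_solutions_transform[OF K_iff_L slack dual]

  have B: "B_part I A b K c = B_part P ?A ?b L c"
  proof -
    have interior: "M j *v s \<in> interior_in (?VL j) (L j) \<longleftrightarrow> s \<in> interior_in (?VK j) (K j)"
      if s: "s \<in> K j" for j s
    proof -
      have "M j *v s \<in> L j" using s K(1)[of j] K_iff_L[of s j] by blast
      then show ?thesis
        using M_boundary[OF s] boundary_in_iff_not_interior_in[OF s K(1)]
          boundary_in_iff_not_interior_in[OF _ L(1)] by blast
    qed
    show ?thesis
    proof (intro equalityI subsetI)
      fix j assume "j \<in> B_part I A b K c"
      then obtain x y where xy: "(x, y) \<in> ?S" "slack A b x $ j \<in> interior_in (?VK j) (K j)"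
        by (auto simp: B_part_def)
      then have "y \<in> dual_cone (prod_space I) (prod_set K)"
        unfolding dual_cone_prod_set[of K, OF K(3)] by (auto simp: compl_solutions_def prod_set_def)
      then obtain z where "y = block_map_transpose M z" "z \<in> prod_set (\<lambda>j. dual_cone (?VL j) (L j))"
        unfolding prod_dual dual_cone_prod_set[of L, OF L(5)] by blast
      then have "(x, z) \<in> ?S'" using xy(1) sol by simp
      moreover have "slack A b x $ j \<in> K j" using xy(1) by (simp add: compl_solutions_def)
      ultimately show "j \<in> B_part P ?A ?b L c"
        using xy(2) interior by (auto simp: B_part_def slack_transform block_map_def)
    next
      fix j assume "j \<in> B_part P ?A ?b L c"
      then obtain x z where xz: "(x, z) \<in> ?S'"
          "M j *v (slack A b x $ j) \<in> interior_in (?VL j) (L j)"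
        by (auto simp: B_part_def slack_transform block_map_def)
      have "(x, block_map_transpose M z) \<in> ?S" using xz(1) sol by blast
      moreover from this have "slack A b x $ j \<in> K j" by (simp add: compl_solutions_def)
      ultimately show "j \<in> B_part I A b K c"
        using xz(2) interior by (auto simp: B_part_def)
    qed
  qed

  have N: "N_part I A b K c = N_part P ?A ?b L c"
  proof -
    have "interior_in (?VK j) (dual_cone (?VK j) (K j))
        = (\<lambda>z. transpose (M j) *v z) ` interior_in (?VL j) (dual_cone (?VL j) (L j))" for j
      unfolding interior_dual_cone_eq_rel_interior[OF subspace_coord_space K_cone]
        interior_dual_cone_eq_rel_interior[OF subspace_coord_space L_cone]
      unfolding dual
      by (rule rel_interior_convex_linear_image[symmetric])
        (auto simp: convex_cone_dual_cone subspace_coord_space)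
    moreover have "interior_in (?VL j) (dual_cone (?VL j) (L j)) \<subseteq> dual_cone (?VL j) (L j)" for j
      by (simp add: interior_in_def interior_of_subset)
    ultimately show ?thesis
      unfolding N_part_def
      using dual_block_transform[OF K_iff_L slack dual,
          where X = "\<lambda>_. interior_in (?VK j) (dual_cone (?VK j) (K j))"
            and Y = "\<lambda>_. interior_in (?VL j) (dual_cone (?VL j) (L j))" for j]
      by blast
  qed

  have R0: "R0_part I A b K c = R0_part P ?A ?b L c"
  proof -
    have "{y. - y \<in> rel_interior (normal_cone (?VK j) (K j) s)}
        = (\<lambda>z. transpose (M j) *v z) `
            {z. - z \<in> rel_interior (normal_cone (?VL j) (L j) (M j *v s))}"
      if "s \<in> ?VK j" "s \<in> K j" for j s
    proof -
      have "M j *v s \<in> L j" using K_iff_L that by blast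
      then have ri: "rel_interior (normal_cone (?VK j) (K j) s)
          = (\<lambda>z. transpose (M j) *v z) ` rel_interior (normal_cone (?VL j) (L j) (M j *v s))"
        using rel_interior_normal_cone_preimage[OF subspace_coord_space subspace_coord_space
            matrix_vector_mul_linear inner_transpose K(2) L(4) that(2) _ dual] by blast
      have neg: "{v. - v \<in> R} = uminus ` R" for R :: "(real ^ 'd) set" by force
      show ?thesis unfolding neg ri image_image by (simp add: linear_neg[OF matrix_vector_mul_linear])
    qed
    moreover have "{z. - z \<in> rel_interior (normal_cone (?VL j) (L j) t)} \<subseteq> dual_cone (?VL j) (L j)"
      if "t \<in> L j" for j t
      using normal_cone_cone[OF subspace_coord_space L(4) that, of "P j"] rel_interior_subset by fastforce
    ultimately show ?thesis
      unfolding R0_part_def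
      using dual_block_transform[OF K_iff_L slack dual,
          where X = "\<lambda>s. {y. - y \<in> rel_interior (normal_cone (?VK j) (K j) s)}"
            and Y = "\<lambda>t. {z. - z \<in> rel_interior (normal_cone (?VL j) (L j) t)}" for j]
      by simp
  qed

  have "strict_complementarity I A b K c \<longleftrightarrow> strict_complementarity P ?A ?b L c"
  proof -
    have ri: "rel_interior (normal_cone (prod_space I) (prod_set K) (slack A b x))
        = block_map_transpose M `
            rel_interior (normal_cone (prod_space P) (prod_set L) (slack ?A ?b x))"
      and normal: "normal_cone (prod_space P) (prod_set L) (slack ?A ?b x)
        = {v. - v \<in> prod_set (\<lambda>j. dual_cone (?VL j) (L j)) \<and> v \<bullet> slack ?A ?b x = 0}"
      if "(x, y) \<in> ?S" for x y
    proof -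
      have sK: "slack A b x \<in> prod_set K"
        using that by (simp add: compl_solutions_def prod_set_def)
      then have sL: "block_map M (slack A b x) \<in> prod_set L"
        using slack[of x] K_iff_L by (simp add: prod_set_def block_map_def)
      show "rel_interior (normal_cone (prod_space I) (prod_set K) (slack A b x))
        = block_map_transpose M `
            rel_interior (normal_cone (prod_space P) (prod_set L) (slack ?A ?b x))"
        unfolding slack_transform
        by (rule rel_interior_normal_cone_preimage[OF spaces linear_block_map
              inner_block_map_transpose cone_prod_set cone_prod_set sK sL prod_dual])
          (fact K(2) L(4))+
      show "normal_cone (prod_space P) (prod_set L) (slack ?A ?b x)
        = {v. - v \<in> prod_set (\<lambda>j. dual_cone (?VL j) (L j)) \<and> v \<bullet> slack ?A ?b x = 0}"
        unfolding slack_transform dual_cone_prod_set[of L, OF L(5), symmetric]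
        by (rule normal_cone_cone[OF spaces(2) cone_prod_set[OF L(4)] sL])
    qed
    show ?thesis
    proof
      assume "strict_complementarity I A b K c"
      then obtain x y where xy: "(x, y) \<in> ?S"
          "- y \<in> rel_interior (normal_cone (prod_space I) (prod_set K) (slack A b x))"
        by (auto simp: strict_complementarity_def)
      then obtain v where v: "- y = block_map_transpose M v"
          "v \<in> rel_interior (normal_cone (prod_space P) (prod_set L) (slack ?A ?b x))"
        unfolding ri[OF xy(1)] by blast
      have "y = block_map_transpose M (- v)"
        using v(1) linear_neg[OF linear_block_map] by (metis minus_minus)
      moreover have "- v \<in> prod_set (\<lambda>j. dual_cone (?VL j) (L j))"
        using v(2) normal[OF xy(1)] rel_interior_subset by blast
      ultimately have "(x, - v) \<in> ?S'" using xy(1) sol by simp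
      then show "strict_complementarity P ?A ?b L c"
        using v(2) by (force simp: strict_complementarity_def)
    next
      assume "strict_complementarity P ?A ?b L c"
      then obtain x z where xz: "(x, z) \<in> ?S'"
          "- z \<in> rel_interior (normal_cone (prod_space P) (prod_set L) (slack ?A ?b x))"
        by (auto simp: strict_complementarity_def)
      have S: "(x, block_map_transpose M z) \<in> ?S" using xz(1) sol by blast
      have "- block_map_transpose M z = block_map_transpose M (- z)"
        using linear_neg[OF linear_block_map] by metis
      then have "- block_map_transpose M z
          \<in> rel_interior (normal_cone (prod_space I) (prod_set K) (slack A b x))"
        unfolding ri[OF S] using xz(2) by simp
      with S show "strict_complementarity I A b K c"
        by (auto simp: strict_complementarity_def)
    qed
  qed
  with B N R0 show ?thesis by (simp add: R_part_def T_part_def)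
qed

end
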